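(* Let $k$ be a field, let $V$ be a $k$-vector space, and let $\eta : V \otimes V \to V$, $\eta(x \otimes y) = xy$, be a linear map which satisfies, for all $a,b,c \in V$ (with $a^2 = aa$), $$(ab)c + (bc)a + (ca)b = a(bc) + b(ca) + c(ab), \qquad (1)$$ $$(a^2 b)a = a^2(ba). \qquad (2)$$ Then $(V,\eta)$ is a structure which unifies (non-unital) associative algebras, Lie algebras and Jordan algebras. Indeed, the associativity and the Lie identity are unified by relation (1); also, the commutativity of a Jordan algebra implies (1); and the Jordan identity (2), which appears in the definition of Jordan algebras, holds true in any associative algebra and in any Lie algebra. This unifying approach is different from the unification of associative algebras and non-associative structures at the level of Yang-Baxter structures.
   Context: Tensor products are over $k$. A Lie algebra is a $k$-vector space with a bilinear product $xy=[x,y]$ satisfying $[x,x]=0$ and the Lie (Jacobi) identity $[x,[y,z]]+[y,[z,x]]+[z,[x,y]]=0$. A Jordan algebra is a $k$-vector space with a bilinear product that is commutative, $xy=yx$, and satisfies the Jordan identity $(x^2y)x=x^2(yx)$. Non-unital means that no unit is assumed. The unification at the level of Yang-Baxter structures refers to associating invertible linear maps $R: W\otimes W\to W\otimes W$ satisfying $(R\otimes I)(I\otimes R)(R\otimes I)=(I\otimes R)(R\otimes I)(I\otimes R)$ both to a unital associative algebra $A$, via $a\otimes b\mapsto \alpha\, ab\otimes 1+\beta\, 1\otimes ab-\gamma\, a\otimes b$ for suitable scalars $\alpha,\beta,\gamma\in k$, and to a Lie superalgebra $L$, via $x\otimes y\mapsto \alpha[x,y]\otimes z+(-1)^{|x||y|}y\otimes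 x$ with $\alpha\in k$, $z$ a central element of degree $0$, and $|x|\in\{0,1\}$ denoting the degree of a homogeneous element $x$. The word "unifies" is used informally; its meaning is the one explained in the sentence beginning "Indeed". *)

theory Defs
  imports Complex_Main
begin

definition assoc_identity :: "('v \<Rightarrow> 'v \<Rightarrow> 'v) \<Rightarrow> bool" where
  "assoc_identity m \<longleftrightarrow> (\<forall>a b c. m (m a b) c = m a (m b c))"

definition commutative_identity :: "('v \<Rightarrow> 'v \<Rightarrow> 'v) \<Rightarrow> bool" where
  "commutative_identity m \<longleftrightarrow> (\<forall>a b. m a b = m b a)"

definition alternating_identity :: "('v::zero \<Rightarrow> 'v \<Rightarrow> 'v) \<Rightarrow> bool" where
  "alternating_identity m \<longleftrightarrow> (\<forall>x. m x x = 0)"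

definition lie_identity :: "('v::ab_group_add \<Rightarrow> 'v \<Rightarrow> 'v) \<Rightarrow> bool" where
  "lie_identity m \<longleftrightarrow> (\<forall>x y z. m x (m y z) + m y (m z x) + m z (m x y) = 0)"

definition jordan_identity :: "('v \<Rightarrow> 'v \<Rightarrow> 'v) \<Rightarrow> bool" where
  "jordan_identity m \<longleftrightarrow> (\<forall>a b. m (m (m a a) b) a = m (m a a) (m b a))"

definition cyclic_assoc_identity :: "('v::ab_group_add \<Rightarrow> 'v \<Rightarrow> 'v) \<Rightarrow> bool" where
  "cyclic_assoc_identity m \<longleftrightarrow>
     (\<forall>a b c. m (m a b) c + m (m b c) a + m (m c a) b
            = m a (m b c) + m b (m c a) + m c (m a b))"

text \<open>A linear map from the tensor square of a vector space to that space is given, through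
  the universal property of the tensor product, by a product that is linear in each argument.
  No associativity and no unit is assumed.\<close>

locale nonassoc_algebra = vector_space scale
  for scale :: "'k::field \<Rightarrow> 'v::ab_group_add \<Rightarrow> 'v" +
  fixes mult :: "'v \<Rightarrow> 'v \<Rightarrow> 'v"
  assumes linear_left: "\<And>y. Vector_Spaces.linear scale scale (\<lambda>x. mult x y)"
    and linear_right: "\<And>x. Vector_Spaces.linear scale scale (\<lambda>y. mult x y)"

locale associative_algebra = nonassoc_algebra +
  assumes associative: "assoc_identity mult"

locale lie_algebra = nonassoc_algebra +
  assumes alternating: "alternating_identity mult"
    and lie: "lie_identity mult"

locale jordan_algebra = nonassoc_algebra +
  assumes commutative: "commutative_identity mult"
    and jordan: "jordan_identity mult"

locale unified_algebra = nonassoc_algebra +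
  assumes cyclic_assoc: "cyclic_assoc_identity mult"
    and jordan: "jordan_identity mult"

end

theory Submission imports Defs begin

text \<open>Relation (1) equates two cyclic sums. Associativity matches them term by term,
  commutativity matches them up to a permutation of the terms, and in a Lie algebra both are zero
  (\<open>cyclic_assoc_if_lie\<close>). The Jordan identity is an instance of reassociation in the
  associative case; in the Lie case it collapses because squares vanish
  (\<open>jordan_if_alternating\<close>).\<close>

lemma cyclic_assoc_if_assoc: "assoc_identity m \<Longrightarrow> cyclic_assoc_identity m"
  by (simp add: assoc_identity_def cyclic_assoc_identity_def)

text \<open>Commuting the outer product turns (ab)c, (bc)a, (ca)b into c(ab), a(bc), b(ca), which
  are the terms of the other side in a different order.\<close>

lemma cyclic_assoc_if_commutative: "commutative_identity m \<Longrightarrow> cyclic_assoc_identity m"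
  unfolding commutative_identity_def cyclic_assoc_identity_def by (metis add.commute add.assoc)

lemma jordan_if_assoc: "assoc_identity m \<Longrightarrow> jordan_identity m"
  by (simp add: assoc_identity_def jordan_identity_def)

context nonassoc_algebra
begin

lemma mult_add_left: "mult (x + y) z = mult x z + mult y z"
  using linear_left by (rule Vector_Spaces.linear.axioms(3)[THEN module_hom.add])

lemma mult_add_right: "mult x (y + z) = mult x y + mult x z"
  using linear_right by (rule Vector_Spaces.linear.axioms(3)[THEN module_hom.add])

lemma mult_zero_left: "mult 0 x = 0"
  using mult_add_left[of 0 0 x] by simp

lemma anticommutative_if_alternating:
  assumes "alternating_identity mult"
  shows "mult x y = - mult y x"
proof -
  have sq: "mult z z = 0" for z
    using assms by (simp add: alternating_identity_def)
  \<comment> \<open>Polarization: the cross terms are all that survives in the square of x + y.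
    Instantiating \<open>sq\<close> at x and y only lets this square be expanded before it is
    rewritten to 0.\<close>
  have "mult x y + mult y x = mult (x + y) (x + y)"
    by (simp add: mult_add_left mult_add_right sq[of x] sq[of y])
  then show ?thesis
    by (simp add: sq eq_neg_iff_add_eq_0)
qed

text \<open>Both sides of the cyclic relation vanish: the right-hand side is the Jacobi sum, and
  the left-hand side is its negative by anticommutativity.\<close>

lemma cyclic_assoc_if_lie:
  assumes "alternating_identity mult" "lie_identity mult"
  shows "cyclic_assoc_identity mult"
  unfolding cyclic_assoc_identity_def
proof (intro allI)
  fix a b c
  let ?J = "mult a (mult b c) + mult b (mult c a) + mult c (mult a b)"
  have "?J = 0"
    using assms(2) by (simp add: lie_identity_def)
  moreover have "mult (mult a b) c + mult (mult b c) a + mult (mult c a) b = - ?J"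
    using anticommutative_if_alternating[OF assms(1), of "mult a b" c]
      anticommutative_if_alternating[OF assms(1), of "mult b c" a]
      anticommutative_if_alternating[OF assms(1), of "mult c a" b]
    by (simp add: algebra_simps)
  ultimately show "mult (mult a b) c + mult (mult b c) a + mult (mult c a) b = ?J"
    by simp
qed

text \<open>Since aa = 0, both sides are products that start from a left factor 0.\<close>

lemma jordan_if_alternating: "alternating_identity mult \<Longrightarrow> jordan_identity mult"
  by (simp add: alternating_identity_def jordan_identity_def mult_zero_left)

end

theorem mainTheorem1:
  fixes scale :: "'k::field \<Rightarrow> 'v::ab_group_add \<Rightarrow> 'v"
    and mult :: "'v \<Rightarrow> 'v \<Rightarrow> 'v"
  assumes "nonassoc_algebra scale mult"
  shows "(associative_algebra scale mult \<longrightarrow> unified_algebra scale mult)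
       \<and> (lie_algebra scale mult \<longrightarrow> unified_algebra scale mult)
       \<and> (jordan_algebra scale mult \<longrightarrow> unified_algebra scale mult)
       \<and> (assoc_identity mult \<longrightarrow> cyclic_assoc_identity mult)
       \<and> (alternating_identity mult \<and> lie_identity mult \<longrightarrow> cyclic_assoc_identity mult)
       \<and> (commutative_identity mult \<longrightarrow> cyclic_assoc_identity mult)
       \<and> (associative_algebra scale mult \<longrightarrow> jordan_identity mult)
       \<and> (lie_algebra scale mult \<longrightarrow> jordan_identity mult)"
proof -
  interpret nonassoc_algebra scale mult
    by (fact assms)
  \<comment> \<open>Bilinearity is common to all the structures, so each inclusion reduces to the
    two identities.\<close>
  have unified: "unified_algebra scale mult"
    if "cyclic_assoc_identity mult" "jordan_identity mult"
    using that assms by (simp add: unified_algebra_def unified_algebra_axioms_def)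
  show ?thesis
    using unified cyclic_assoc_if_assoc cyclic_assoc_if_commutative jordan_if_assoc
      cyclic_assoc_if_lie jordan_if_alternating
    by (auto simp: associative_algebra_def associative_algebra_axioms_def
        lie_algebra_def lie_algebra_axioms_def jordan_algebra_def jordan_algebra_axioms_def)
qed

end
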